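(* Let $p\in(1,\infty)$. There exists a constant $C_p>0$ depending only on $p$ such that for all $n\in\mathbb{N}=\{1,2,\ldots\}$ and all $\boldsymbol{\sigma}\in\{0,1\}^n$ the point set $\widetilde{\mathcal{R}}_{n,\boldsymbol{\sigma}}^{\mathrm{sym}}$, which has $N=2^{n+1}$ elements counted with multiplicity, satisfies $$L_{p,N}(\widetilde{\mathcal{R}}_{n,\boldsymbol{\sigma}}^{\mathrm{sym}})\le C_p\,\frac{\sqrt{\log N}}{N}.$$
   Context: For a finite multiset $\mathcal{P}=\{\boldsymbol{x}_0,\ldots,\boldsymbol{x}_{N-1}\}$ of $N$ points (counted with multiplicity) in $[0,1]^2$, the local discrepancy is $$D_N(\mathcal{P},\boldsymbol{t})=\frac{A_N([\boldsymbol{0},\boldsymbol{t}),\mathcal{P})}{N}-t_1t_2,\qquad \boldsymbol{t}=(t_1,t_2)\in[0,1]^2,$$ where $A_N([\boldsymbol{0},\boldsymbol{t}),\mathcal{P})$ is the number of indices $k$ with $\boldsymbol{x}_k\in[\boldsymbol{0},\boldsymbol{t}):=[0,t_1)\times[0,t_2)$. The $L_p$-discrepancy is $$L_{p,N}(\mathcal{P})=\left(\int_{[0,1]^2}|D_N(\mathcal{P},\boldsymbol{t})|^p\,\mathrm{d}\boldsymbol{t}\right)^{1/p}.$$ For $\boldsymbol{\sigma}=(\sigma_1,\ldots,\sigma_n)\in\{0,1\}^n$ the two-dimensional digit shifted Hammersley point set is $$\mathcal{R}_{n,\boldsymbol{\sigma}}=\Big\{\Big(\frac{t_n}{2}+\frac{t_{n-1}}{2^2}+\cdots+\frac{t_1}{2^n},\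 \frac{t_1\oplus\sigma_1}{2}+\frac{t_2\oplus\sigma_2}{2^2}+\cdots+\frac{t_n\oplus\sigma_n}{2^n}\Big) : t_1,\ldots,t_n\in\{0,1\}\Big\},$$ where $t\oplus\sigma=t+\sigma \pmod 2$. It has $2^n$ elements. Define $$\widetilde{\mathcal{R}}_{n,\boldsymbol{\sigma}}^{\mathrm{sym}}=\mathcal{R}_{n,\boldsymbol{\sigma}}\cup\{(x,1-y) : (x,y)\in\mathcal{R}_{n,\boldsymbol{\sigma}}\},$$ understood as a multiset union (coinciding points are counted with multiplicity), so that it has $N=2^{n+1}$ elements. $\log$ is the natural logarithm. *)

theory Defs
  imports "HOL-Analysis.Analysis" "HOL-Library.Multiset" "HOL-Library.FuncSet"
begin

definition local_disc :: "(real \<times> real) multiset \<Rightarrow> real \<times> real \<Rightarrow> real" where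
  "local_disc P t =
     real (size {#x \<in># P. x \<in> {0..<fst t} \<times> {0..<snd t}#}) / real (size P) - fst t * snd t"

definition Lp_disc :: "real \<Rightarrow> (real \<times> real) multiset \<Rightarrow> real" where
  "Lp_disc p P =
     (LINT t:{0..1} \<times> {0..1}|lborel. \<bar>local_disc P t\<bar> powr p) powr (1 / p)"

text \<open>Words in \<open>{0,1}\<^sup>n\<close> are extensional functions on the index set \<open>{1..n}\<close>.\<close>

definition bits :: "nat \<Rightarrow> (nat \<Rightarrow> nat) set" where
  "bits n = ({1..n} \<rightarrow>\<^sub>E {0, 1})"

text \<open>In the first coordinate the digits appear in reversed order: digit \<open>t i\<close> has
  weight \<open>1 / 2 ^ (n + 1 - i)\<close>, where the subtraction never truncates as \<open>i \<le> n\<close>.\<close>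

definition hammersley :: "nat \<Rightarrow> (nat \<Rightarrow> nat) \<Rightarrow> (real \<times> real) set" where
  "hammersley n \<sigma> =
     {(\<Sum>i=1..n. real (t i) / 2 ^ (n + 1 - i),
       \<Sum>i=1..n. real ((t i + \<sigma> i) mod 2) / 2 ^ i) | t. t \<in> bits n}"

text \<open>The sum of multisets keeps the multiplicity of points lying in both parts.\<close>

definition sym_hammersley :: "nat \<Rightarrow> (nat \<Rightarrow> nat) \<Rightarrow> (real \<times> real) multiset" where
  "sym_hammersley n \<sigma> =
     mset_set (hammersley n \<sigma>) + mset_set {(x, 1 - y) | x y. (x, y) \<in> hammersley n \<sigma>}"

end

theory Submission
  imports Defs
begin

text \<open>
  Identify a grid point \<open>(a, b) \<in> {0..<2\<^sup>n}\<^sup>2\<close> with its pairs of digits, taking the digits of \<open>a\<close>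
  from the least and those of \<open>b\<close> from the most significant one. Adding one pair of digits
  changes the counting error of the shifted Hammersley set by a bounded amount, whose mean over
  the new pair is a multiple of a quantity \<open>Z\<close> (\<open>row_error\<close> below) plus a term depending only on the shift. That term
  is cancelled by the reflected set, which up to a vertical translation by \<open>2\<^sup>-\<^sup>n\<close> is the
  Hammersley set for the complementary shift, while the mean of the next \<open>Z\<close> is half the
  present one. Adding half of \<open>Z\<close> therefore turns the symmetrized counting error into a martingale
  with bounded increments. As in the Azuma-Hoeffding inequality, its exponential moment
  at scale \<open>1 / sqrt n\<close> is bounded, and this controls every \<open>L\<^sub>p\<close> norm with \<open>p < \<infinity>\<close>.
\<close>

section \<open>Shifted digit reversal\<close>

text \<open>For \<open>y < 2 ^ n\<close>, the point at ordinate \<open>y / 2 ^ n\<close> has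
  abscissa \<open>digit_rev \<sigma> n y / 2 ^ n\<close>. The last binary digit of \<open>y\<close>,
  freed of the shift, becomes the leading digit of the abscissa, so the recursion adds one pair of
  digits at a time.\<close>

fun digit_rev :: "(nat \<Rightarrow> nat) \<Rightarrow> nat \<Rightarrow> nat \<Rightarrow> nat" where
  "digit_rev \<sigma> 0 y = 0"
| "digit_rev \<sigma> (Suc n) y = digit_rev \<sigma> n (y div 2) + 2 ^ n * ((y + \<sigma> (Suc n)) mod 2)"

lemma digit_rev_less: "digit_rev \<sigma> n y < 2 ^ n"
proof (induction n arbitrary: y)
  case (Suc n)
  have "2 ^ n * ((y + \<sigma> (Suc n)) mod 2) \<le> (2::nat) ^ n * 1"
    by (intro mult_le_mono) auto
  then have "2 ^ n * ((y + \<sigma> (Suc n)) mod 2) \<le> (2::nat) ^ n"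
    by (simp only: mult_1_right)
  then have "digit_rev \<sigma> (Suc n) y < 2 ^ n + 2 ^ n"
    unfolding digit_rev.simps by (intro add_less_le_mono Suc.IH)
  then show ?case by (simp only: power_Suc mult_2)
qed simp

lemma mod2_add_twice: "((t + s) mod 2 + s) mod 2 = t mod (2::nat)"
proof -
  have "((t + s) mod 2 + s) mod 2 = (t + s * 2) mod 2"
    by (simp add: mod_add_left_eq mult_2_right add.assoc)
  then show ?thesis by simp
qed

lemma digit_rev_inj: "inj_on (digit_rev \<sigma> n) {..<2 ^ n}"
proof (induction n)
  case (Suc n)
  show ?case
  proof (rule inj_onI)
    fix y z assume yz: "y \<in> {..<2 ^ Suc n}" "z \<in> {..<2 ^ Suc n}"
      and eq: "digit_rev \<sigma> (Suc n) y = digit_rev \<sigma> (Suc n) z"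
    have "digit_rev \<sigma> (Suc n) x mod 2 ^ n = digit_rev \<sigma> n (x div 2)"
      "digit_rev \<sigma> (Suc n) x div 2 ^ n = (x + \<sigma> (Suc n)) mod 2" for x
      using digit_rev_less[of \<sigma> n "x div 2"] by simp_all
    then have "digit_rev \<sigma> n (y div 2) = digit_rev \<sigma> n (z div 2)"
      and m: "(y + \<sigma> (Suc n)) mod 2 = (z + \<sigma> (Suc n)) mod 2"
      using eq by metis+
    then have "y div 2 = z div 2"
      using yz by (elim inj_onD[OF Suc]) auto
    moreover have "y mod 2 = z mod 2" using m by (metis mod2_add_twice)
    ultimately show "y = z" by (metis div_mult_mod_eq)
  qed
qed (simp add: inj_on_def)

text \<open>Only the parity of the shift matters, so \<open>Suc \<circ> \<sigma>\<close> is the complementary shift.\<close>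

lemma digit_rev_complement:
  assumes "y < 2 ^ n"
  shows "digit_rev (Suc \<circ> \<sigma>) n (2 ^ n - 1 - y) = digit_rev \<sigma> n y"
  using assms
proof (induction n arbitrary: y)
  case (Suc n)
  have "y div 2 < 2 ^ n" using Suc.prems by auto
  moreover have "(2 * k - 1 - y) div 2 = k - 1 - y div 2" if "y < 2 * k" for k :: nat
    using that by linarith
  moreover have "(2 * k - 1 - y + Suc s) mod 2 = (y + s) mod 2" if "y < 2 * k" for k s :: nat
  proof -
    have "2 * k - 1 - y + Suc s + (y + s) = 2 * (k + s)" using that by simp
    then have "even (2 * k - 1 - y + Suc s + (y + s))" by (simp only: dvd_triv_left)
    then show ?thesis unfolding mod2_eq_if even_add[of _ "y + s"] by simp
  qed
  ultimately have "y div 2 < 2 ^ n" "(2 ^ Suc n - 1 - y) div 2 = 2 ^ n - 1 - y div 2"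
    "(2 ^ Suc n - 1 - y + Suc (\<sigma> (Suc n))) mod 2 = (y + \<sigma> (Suc n)) mod 2"
    using Suc.prems unfolding power_Suc by blast+
  then show ?case using Suc.IH[of "y div 2"] by (simp only: digit_rev.simps o_def)
qed simp

section \<open>Parametrization of the Hammersley set by its ordinates\<close>

lemma digit_rev_of_digits:
  assumes "\<forall>i\<in>{1..n}. t i \<in> {0, 1}"
  shows "digit_rev \<sigma> n (\<Sum>i=1..n. (t i + \<sigma> i) mod 2 * 2 ^ (n - i)) = (\<Sum>i=1..n. t i * 2 ^ (i - 1))"
    and "(\<Sum>i=1..n. (t i + \<sigma> i) mod 2 * 2 ^ (n - i)) < 2 ^ n"
proof -
  have "digit_rev \<sigma> n (\<Sum>i=1..n. (t i + \<sigma> i) mod 2 * 2 ^ (n - i)) = (\<Sum>i=1..n. t i * 2 ^ (i - 1))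
    \<and> (\<Sum>i=1..n. (t i + \<sigma> i) mod 2 * 2 ^ (n - i)) < 2 ^ n"
    using assms
  proof (induction n)
    case (Suc n)
    let ?Y = "\<lambda>n. \<Sum>i=1..n. (t i + \<sigma> i) mod 2 * 2 ^ (n - i)"
    have "(\<Sum>i=1..n. (t i + \<sigma> i) mod 2 * 2 ^ (Suc n - i)) = 2 * ?Y n"
      unfolding sum_distrib_left by (intro sum.cong) (auto simp: Suc_diff_le)
    then have Y: "?Y (Suc n) = 2 * ?Y n + (t (Suc n) + \<sigma> (Suc n)) mod 2"
      by simp
    have "t (Suc n) \<in> {0, 1}" using Suc.prems by (rule bspec) simp
    then have t: "t (Suc n) < 2" by auto
    have "(?Y (Suc n) + \<sigma> (Suc n)) mod 2 = t (Suc n)"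
      using t unfolding Y by (simp only: add.assoc mod_mult_self4 mod2_add_twice mod_less)
    moreover have "?Y (Suc n) div 2 = ?Y n" unfolding Y by simp
    ultimately have "digit_rev \<sigma> (Suc n) (?Y (Suc n)) = digit_rev \<sigma> n (?Y n) + 2 ^ n * t (Suc n)"
      by (simp only: digit_rev.simps)
    moreover have "(t (Suc n) + \<sigma> (Suc n)) mod 2 \<le> 1" by simp
    ultimately show ?case using Suc Y by simp
  qed simp
  then show "digit_rev \<sigma> n (\<Sum>i=1..n. (t i + \<sigma> i) mod 2 * 2 ^ (n - i)) = (\<Sum>i=1..n. t i * 2 ^ (i - 1))"
    and "(\<Sum>i=1..n. (t i + \<sigma> i) mod 2 * 2 ^ (n - i)) < 2 ^ n" by auto
qed

lemma digits_exist:
  assumes "y < 2 ^ n"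
  shows "\<exists>t\<in>bits n. (\<Sum>i=1..n. (t i + \<sigma> i) mod 2 * 2 ^ (n - i)) = y"
  using assms
proof (induction n arbitrary: y)
  case 0
  then show ?case by (auto simp: bits_def)
next
  case (Suc n)
  have "y div 2 < 2 ^ n" using Suc.prems by auto
  then obtain t where t: "t \<in> bits n" "(\<Sum>i=1..n. (t i + \<sigma> i) mod 2 * 2 ^ (n - i)) = y div 2"
    using Suc.IH by blast
  define u where "u = t(Suc n := (y + \<sigma> (Suc n)) mod 2)"
  have "u \<in> bits (Suc n)"
    using t(1) unfolding bits_def u_def PiE_iff extensional_def by (auto simp: le_Suc_eq)
  moreover have "(\<Sum>i=1..n. (u i + \<sigma> i) mod 2 * 2 ^ (Suc n - i)) = 2 * (y div 2)"
    unfolding t(2)[symmetric] sum_distrib_left u_def by (intro sum.cong) (auto simp: Suc_diff_le)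
  then have "(\<Sum>i=1..Suc n. (u i + \<sigma> i) mod 2 * 2 ^ (Suc n - i)) = y"
    by (simp add: u_def mod2_add_twice)
  ultimately show ?case by blast
qed

text \<open>Every row \<open>y\<close> carries exactly one point, since the ordinate determines all
  digits \<open>t i\<close> and hence the abscissa.\<close>

lemma hammersley_eq:
  "hammersley n \<sigma> = (\<lambda>y. (real (digit_rev \<sigma> n y) / 2 ^ n, real y / 2 ^ n)) ` {..<2 ^ n}"
proof -
  let ?Y = "\<lambda>t. \<Sum>i=1..n. (t i + \<sigma> i) mod 2 * 2 ^ (n - i)"
  have x: "(\<Sum>i=1..n. real (t i) / 2 ^ (n + 1 - i)) = real (\<Sum>i=1..n. t i * 2 ^ (i - 1)) / 2 ^ n" for t
    unfolding of_nat_sum sum_divide_distrib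
  proof (intro sum.cong refl)
    fix i assume i: "i \<in> {1..n}"
    then have "(2::real) ^ n = 2 ^ (n + 1 - i) * 2 ^ (i - 1)"
      unfolding power_add[symmetric] by (intro arg_cong[where f = "power 2"]) auto
    then show "real (t i) / 2 ^ (n + 1 - i) = real (t i * 2 ^ (i - 1)) / 2 ^ n"
      by simp
  qed
  have y: "(\<Sum>i=1..n. real ((t i + \<sigma> i) mod 2) / 2 ^ i) = real (?Y t) / 2 ^ n" for t
    unfolding of_nat_sum sum_divide_distrib
  proof (intro sum.cong refl)
    fix i assume i: "i \<in> {1..n}"
    then have "(2::real) ^ n = 2 ^ i * 2 ^ (n - i)"
      unfolding power_add[symmetric] by (intro arg_cong[where f = "power 2"]) auto
    then show "real ((t i + \<sigma> i) mod 2) / 2 ^ i = real ((t i + \<sigma> i) mod 2 * 2 ^ (n - i)) / 2 ^ n"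
      by simp
  qed
  have pt: "(\<Sum>i=1..n. t i * 2 ^ (i - 1)) = digit_rev \<sigma> n (?Y t)" "?Y t < 2 ^ n" if "t \<in> bits n" for t
  proof -
    have "\<forall>i\<in>{1..n}. t i \<in> {0, 1}" using that by (auto simp: bits_def PiE_iff)
    from digit_rev_of_digits[OF this] show "(\<Sum>i=1..n. t i * 2 ^ (i - 1)) = digit_rev \<sigma> n (?Y t)" "?Y t < 2 ^ n"
      by simp_all
  qed
  have "?Y ` bits n = {..<2 ^ n}"
    using pt(2) digits_exist[of _ n \<sigma>] by (auto simp: image_iff)
  moreover have "hammersley n \<sigma> =
    (\<lambda>y. (real (digit_rev \<sigma> n y) / 2 ^ n, real y / 2 ^ n)) ` ?Y ` bits n"
    unfolding hammersley_def x y Setcompr_eq_image image_image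
    by (intro image_cong refl) (simp only: pt(1))
  ultimately show ?thesis by (simp only:)
qed

section \<open>The counting error on the grid\<close>

definition grid_count :: "(nat \<Rightarrow> nat) \<Rightarrow> nat \<Rightarrow> nat \<Rightarrow> nat \<Rightarrow> nat" where
  "grid_count \<sigma> n a b = card {y. y < b \<and> digit_rev \<sigma> n y < a}"

definition grid_error :: "(nat \<Rightarrow> nat) \<Rightarrow> nat \<Rightarrow> nat \<Rightarrow> nat \<Rightarrow> real" where
  "grid_error \<sigma> n a b = real (grid_count \<sigma> n a b) - real a * real b / 2 ^ n"

text \<open>The increment of the error when row \<open>b\<close> is added: that row holds one point,
  and a uniform law would place it left of column \<open>a\<close> with probability
  \<open>a / 2 ^ n\<close>.\<close>

definition row_error :: "(nat \<Rightarrow> nat) \<Rightarrow> nat \<Rightarrow> nat \<Rightarrow> nat \<Rightarrow> real" where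
  "row_error \<sigma> n a b = of_bool (digit_rev \<sigma> n b < a) - real a / 2 ^ n"

lemma grid_count_Suc_row:
  "grid_count \<sigma> n a (Suc b) = grid_count \<sigma> n a b + of_bool (digit_rev \<sigma> n b < a)"
proof -
  have "{y. y < Suc b \<and> digit_rev \<sigma> n y < a} =
    (if digit_rev \<sigma> n b < a then insert b {y. y < b \<and> digit_rev \<sigma> n y < a}
     else {y. y < b \<and> digit_rev \<sigma> n y < a})"
    by (auto simp: less_Suc_eq)
  then show ?thesis by (simp add: grid_count_def)
qed

lemma grid_count_0 [simp]: "grid_count \<sigma> n a 0 = 0"
  by (simp add: grid_count_def)

text \<open>Rows \<open>2 * b\<close> and \<open>2 * b + 1\<close> of the next level carry the point
  of row \<open>b\<close> once in the left half and once, translated by \<open>2 ^ n\<close>, in the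
  right half; the shift only decides the order. Columns below \<open>a\<close> see the left copies
  alone.\<close>

lemma grid_count_low:
  assumes "a < 2 ^ n"
  shows "grid_count \<sigma> (Suc n) a (2 * b) = grid_count \<sigma> n a b"
  using assms digit_rev_less[of \<sigma> n]
  by (induction b) (auto simp: grid_count_Suc_row mod2_eq_if trans_less_add1)

text \<open>Here all \<open>b\<close> left copies are counted in addition to the right copies in
  reach.\<close>

lemma grid_count_high:
  assumes "a < 2 ^ n"
  shows "grid_count \<sigma> (Suc n) (a + 2 ^ n) (2 * b) = grid_count \<sigma> n a b + b"
  using assms digit_rev_less[of \<sigma> n]
  by (induction b) (auto simp: grid_count_Suc_row mod2_eq_if trans_less_add2)

lemma grid_error_Suc_row:
  "grid_error \<sigma> n a (Suc b) = grid_error \<sigma> n a b + row_error \<sigma> n a b"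
  by (simp add: grid_error_def row_error_def grid_count_Suc_row algebra_simps add_divide_distrib)

text \<open>The \<open>b\<close> extra points of \<open>grid_count_high\<close> match the extra area
  exactly. Hence an error can change only through an odd new row, by one
  \<open>row_error\<close>.\<close>

lemma grid_error_step:
  assumes "a < 2 ^ n"
  shows "grid_error \<sigma> (Suc n) a (2 * b) = grid_error \<sigma> n a b"
    and "grid_error \<sigma> (Suc n) (a + 2 ^ n) (2 * b) = grid_error \<sigma> n a b"
  unfolding grid_error_def grid_count_low[OF assms] grid_count_high[OF assms]
  by (simp_all add: field_simps)

lemma row_error_bound:
  assumes "a \<le> 2 ^ n"
  shows "\<bar>row_error \<sigma> n a b\<bar> \<le> 1"
proof -
  have "real a \<le> 2 ^ n" using assms by (metis of_nat_le_iff of_nat_numeral of_nat_power)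
  then have "0 \<le> real a / 2 ^ n" "real a / 2 ^ n \<le> 1" by simp_all
  then show ?thesis unfolding row_error_def by (cases "digit_rev \<sigma> n b < a") auto
qed

text \<open>For either leading digit of the column, the two new rows together contribute
  \<open>row_error \<sigma> n a b\<close>: one copy of the point is counted as before, the other
  always or never.\<close>

lemma row_error_mean:
  assumes "a < 2 ^ n"
  shows "row_error \<sigma> (Suc n) a (2 * b) + row_error \<sigma> (Suc n) a (Suc (2 * b))
    + row_error \<sigma> (Suc n) (a + 2 ^ n) (2 * b) + row_error \<sigma> (Suc n) (a + 2 ^ n) (Suc (2 * b))
    = 2 * row_error \<sigma> n a b"
  using assms digit_rev_less[of \<sigma> n b]
  by (cases "even (\<sigma> (Suc n))")
    (auto simp: row_error_def mod2_eq_if field_simps trans_less_add1 trans_less_add2)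

text \<open>An odd new row changes the grid error by the \<open>row_error\<close> of the even row
  below it. The shift decides which half holds the point of that even row, whence a drift of
  \<open>1 / 2\<close> or \<open>- 1 / 2\<close>.\<close>

lemma row_error_even_mean:
  assumes "a < 2 ^ n"
  shows "row_error \<sigma> (Suc n) a (2 * b) + row_error \<sigma> (Suc n) (a + 2 ^ n) (2 * b)
    = row_error \<sigma> n a b + of_bool (even (\<sigma> (Suc n))) - 1 / 2"
  using assms digit_rev_less[of \<sigma> n b]
  by (cases "even (\<sigma> (Suc n))")
    (auto simp: row_error_def mod2_eq_if field_simps trans_less_add1 trans_less_add2)

section \<open>Exponential moments\<close>

text \<open>The weight \<open>1 / 2\<close> solves \<open>1 / 4 + w / 2 = w\<close>: apart from the
  drift, a new pair of digits raises the mean error by a quarter of the summed row errors and halves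
  the mean of the latter.\<close>

definition corrected_error :: "(nat \<Rightarrow> nat) \<Rightarrow> nat \<Rightarrow> nat \<Rightarrow> nat \<Rightarrow> real" where
  "corrected_error \<sigma> n a b =
     grid_error \<sigma> n a b + grid_error (Suc \<circ> \<sigma>) n a b
     + (row_error \<sigma> n a b + row_error (Suc \<circ> \<sigma>) n a b) / 2"

text \<open>The martingale property. The drifts in \<open>row_error_even_mean\<close> have opposite
  signs for complementary shifts and cancel.\<close>

lemma corrected_error_mean:
  assumes "a < 2 ^ n"
  shows "corrected_error \<sigma> (Suc n) a (2 * b) + corrected_error \<sigma> (Suc n) a (Suc (2 * b))
    + corrected_error \<sigma> (Suc n) (a + 2 ^ n) (2 * b) + corrected_error \<sigma> (Suc n) (a + 2 ^ n) (Suc (2 * b))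
    = 4 * corrected_error \<sigma> n a b"
  using row_error_mean[OF assms, of \<sigma> b] row_error_mean[OF assms, of "Suc \<circ> \<sigma>" b]
    row_error_even_mean[OF assms, of \<sigma> b] row_error_even_mean[OF assms, of "Suc \<circ> \<sigma>" b]
  unfolding corrected_error_def grid_error_Suc_row grid_error_step[OF assms]
  by (cases "even (\<sigma> (Suc n))") (auto simp: field_simps)

text \<open>Each of the two grid errors moves by at most 1, and four row errors, two old and two
  new, enter with weight \<open>1 / 2\<close>: in total \<open>2 + 2\<close>.\<close>

lemma corrected_error_increment:
  assumes "a < 2 ^ n" "a' = a \<or> a' = a + 2 ^ n" "b' = 2 * b \<or> b' = Suc (2 * b)"
  shows "\<bar>corrected_error \<sigma> (Suc n) a' b' - corrected_error \<sigma> n a b\<bar> \<le> 4"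
proof -
  have a': "a' \<le> 2 ^ Suc n" and a: "a \<le> 2 ^ n" using assms by auto
  note bounds = row_error_bound[OF a', of \<sigma> b'] row_error_bound[OF a', of "Suc \<circ> \<sigma>" b']
    row_error_bound[OF a', of \<sigma> "2 * b"] row_error_bound[OF a', of "Suc \<circ> \<sigma>" "2 * b"]
    row_error_bound[OF a, of \<sigma> b] row_error_bound[OF a, of "Suc \<circ> \<sigma>" b]
  have inc: "\<bar>grid_error \<tau> (Suc n) a' b' - grid_error \<tau> n a b\<bar> \<le> 1" for \<tau>
    using assms row_error_bound[OF a', of \<tau> "2 * b"]
    by (auto simp: grid_error_Suc_row grid_error_step)
  show ?thesis
    using bounds inc[of \<sigma>] inc[of "Suc \<circ> \<sigma>"] unfolding corrected_error_def by argo
qed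

lemma exp_le_quadratic:
  fixes x :: real
  assumes "\<bar>x\<bar> \<le> 1"
  shows "exp x \<le> 1 + x + x\<^sup>2"
proof (cases "0 \<le> x")
  case True
  then show ?thesis using assms exp_bound[of x] by simp
next
  case False
  \<comment> \<open>The product is \<open>1 - x ^ 3\<close>, and \<open>x\<close> is
    negative.\<close>
  have "1 \<le> (1 + x + x\<^sup>2) * (1 - x)"
    using False by (simp add: power2_eq_square algebra_simps mult_nonpos_nonneg mult_le_0_iff zero_le_mult_iff)
  also have "\<dots> \<le> (1 + x + x\<^sup>2) * exp (- x)"
  proof (intro mult_left_mono)
    show "1 - x \<le> exp (- x)" using exp_ge_add_one_self[of "- x"] by simp
    show "0 \<le> 1 + x + x\<^sup>2" using assms by (simp add: add_nonneg_nonneg)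
  qed
  finally show ?thesis by (simp add: exp_minus field_simps)
qed

text \<open>A grid point has four successors on the next level: the new digit of \<open>a\<close> is
  its leading one, that of \<open>b\<close> its last one.\<close>

lemma sum_grid_double:
  fixes f :: "nat \<Rightarrow> nat \<Rightarrow> real"
  shows "(\<Sum>a<2 ^ Suc n. \<Sum>b<2 ^ Suc n. f a b) =
    (\<Sum>a<2 ^ n. \<Sum>b<2 ^ n. f a (2 * b) + f a (Suc (2 * b))
       + f (a + 2 ^ n) (2 * b) + f (a + 2 ^ n) (Suc (2 * b)))"
proof -
  have top: "(\<Sum>a<k + k. g a) = (\<Sum>a<k. g a + g (a + k))" for g :: "nat \<Rightarrow> real" and k
  proof -
    have "(\<Sum>a<k + k. g a) = sum g {0..<k} + sum g {0 + k..<k + k}"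
      by (simp add: sum.atLeastLessThan_concat lessThan_atLeast0)
    then show ?thesis unfolding sum.shift_bounds_nat_ivl
      by (simp add: lessThan_atLeast0 sum.distrib)
  qed
  have low: "(\<Sum>b<2 * k. g b) = (\<Sum>b<k. g (2 * b) + g (Suc (2 * b)))" for g :: "nat \<Rightarrow> real" and k
    by (induction k) auto
  have "(\<Sum>a<2 ^ Suc n. \<Sum>b<2 ^ Suc n. f a b) = (\<Sum>a<2 ^ n + 2 ^ n. \<Sum>b<2 * 2 ^ n. f a b)"
    by (simp add: mult_2)
  then show ?thesis
    unfolding top low by (simp add: sum.distrib algebra_simps)
qed

text \<open>Each level costs a factor 4 for the number of successors and a factor
  \<open>1 + (4 * c)\<^sup>2\<close> from the quadratic bound of \<open>exp\<close>: its linear term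
  averages to zero by the martingale property, and its square is controlled by the increment
  bound.\<close>

lemma corrected_error_exp_moment:
  assumes "4 * \<bar>c\<bar> \<le> 1"
  shows "(\<Sum>a<2 ^ n. \<Sum>b<2 ^ n. exp (c * corrected_error \<sigma> n a b)) \<le> (4 * (1 + (4 * c)\<^sup>2)) ^ n"
proof (induction n)
  case 0
  show ?case by (simp add: corrected_error_def grid_error_def grid_count_def row_error_def)
next
  case (Suc n)
  let ?M = "corrected_error \<sigma>"
  have q: "exp (c * ?M (Suc n) a' b')
      \<le> exp (c * ?M n a b) * (1 + c * (?M (Suc n) a' b' - ?M n a b) + (4 * c)\<^sup>2)"
    if "a < 2 ^ n" "a' = a \<or> a' = a + 2 ^ n" "b' = 2 * b \<or> b' = Suc (2 * b)" for a b a' b'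
  proof -
    define d where "d = ?M (Suc n) a' b' - ?M n a b"
    have "\<bar>c * d\<bar> \<le> \<bar>c\<bar> * 4"
      unfolding abs_mult d_def by (intro mult_left_mono corrected_error_increment that) auto
    then have d: "\<bar>c * d\<bar> \<le> \<bar>4 * c\<bar>" by (simp add: abs_mult)
    then have "exp (c * d) \<le> 1 + c * d + (c * d)\<^sup>2"
      using assms by (intro exp_le_quadratic) (simp add: abs_mult)
    also have "(c * d)\<^sup>2 \<le> (4 * c)\<^sup>2" using d by (simp only: abs_le_square_iff)
    finally have "exp (c * d) \<le> 1 + c * d + (4 * c)\<^sup>2" by simp
    then have "exp (c * ?M n a b) * exp (c * d) \<le> exp (c * ?M n a b) * (1 + c * d + (4 * c)\<^sup>2)"
      by simp
    then show ?thesis unfolding exp_add[symmetric] d_def by (simp add: algebra_simps)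
  qed
  have "(\<Sum>a<2 ^ Suc n. \<Sum>b<2 ^ Suc n. exp (c * ?M (Suc n) a b))
    \<le> (\<Sum>a<2 ^ n. \<Sum>b<2 ^ n. exp (c * ?M n a b) * (4 * (1 + (4 * c)\<^sup>2)))"
    unfolding sum_grid_double
  proof (intro sum_mono)
    fix a b assume "a \<in> {..<2 ^ n :: nat}"
    then have a: "a < 2 ^ n" by simp
    \<comment> \<open>With \<open>m\<close> the old value and \<open>f\<close>, \<open>g\<close>,
      \<open>h\<close>, \<open>i\<close> the four new ones, the linear terms add up to
      \<open>c * (f + g + h + i - 4 * m)\<close>, which is 0.\<close>
    have comb: "w + x + y + z \<le> e * (4 * (1 + k))"
      if "w \<le> e * (1 + c * (f - m) + k)" "x \<le> e * (1 + c * (g - m) + k)"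
        "y \<le> e * (1 + c * (h - m) + k)" "z \<le> e * (1 + c * (i - m) + k)"
        and "f + g + h + i = 4 * m" for w x y z e k f g h i m :: real
    proof -
      have "w + x + y + z \<le> e * (1 + c * (f - m) + k) + e * (1 + c * (g - m) + k)
        + e * (1 + c * (h - m) + k) + e * (1 + c * (i - m) + k)"
        using that(1-4) by (intro add_mono)
      also have "\<dots> = e * (4 * (1 + k) + c * (f + g + h + i - 4 * m))"
        by algebra
      finally show ?thesis using that(5) by simp
    qed
    show "exp (c * ?M (Suc n) a (2 * b)) + exp (c * ?M (Suc n) a (Suc (2 * b)))
       + exp (c * ?M (Suc n) (a + 2 ^ n) (2 * b)) + exp (c * ?M (Suc n) (a + 2 ^ n) (Suc (2 * b)))
       \<le> exp (c * ?M n a b) * (4 * (1 + (4 * c)\<^sup>2))"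
      by (rule comb[OF _ _ _ _ corrected_error_mean[OF a, of \<sigma> b]]) (intro q a; blast)+
  qed
  also have "\<dots> = (\<Sum>a<2 ^ n. \<Sum>b<2 ^ n. exp (c * ?M n a b)) * (4 * (1 + (4 * c)\<^sup>2))"
    by (simp only: sum_distrib_right)
  also have "\<dots> \<le> (4 * (1 + (4 * c)\<^sup>2)) ^ n * (4 * (1 + (4 * c)\<^sup>2))"
    by (intro mult_right_mono Suc.IH) auto
  finally show ?case by (simp only: power_Suc2)
qed

lemma corrected_error_exp_moment_sqrt:
  assumes "1 \<le> n"
  shows "(\<Sum>a<2 ^ n. \<Sum>b<2 ^ n. exp (\<bar>corrected_error \<sigma> n a b\<bar> / (4 * sqrt n))) \<le> 2 * exp 1 * 4 ^ n"
proof -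
  \<comment> \<open>With \<open>(4 * c)\<^sup>2 = 1 / n\<close> the growth over \<open>n\<close>
    levels beyond \<open>4 ^ n\<close> is at most \<open>(1 + 1 / n) ^ n \<le> exp 1\<close>. The
    absolute value costs a factor 2, for the moments at \<open>c\<close> and
    \<open>- c\<close>.\<close>
  define c where "c = 1 / (4 * sqrt n)"
  have c: "0 \<le> c" "4 * \<bar>c\<bar> \<le> 1" "(4 * c)\<^sup>2 = 1 / n"
    using assms by (auto simp: c_def power_divide)
  have "(1 + 1 / real n) ^ n \<le> exp (1 / real n) ^ n"
    by (intro power_mono exp_ge_add_one_self) auto
  also have "\<dots> = exp 1" using assms by (simp flip: exp_of_nat_mult)
  finally have e: "(4 * (1 + 1 / real n)) ^ n \<le> exp 1 * 4 ^ n"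
    unfolding power_mult_distrib by simp
  have "(\<Sum>a<2 ^ n. \<Sum>b<2 ^ n. exp (\<bar>corrected_error \<sigma> n a b\<bar> / (4 * sqrt n)))
    \<le> (\<Sum>a<2 ^ n. \<Sum>b<2 ^ n. exp (c * corrected_error \<sigma> n a b) + exp (- c * corrected_error \<sigma> n a b))"
  proof (intro sum_mono)
    fix a b
    have "exp (\<bar>x\<bar> / (4 * sqrt n)) \<le> exp (c * x) + exp (- c * x)" for x
      by (cases "0 \<le> x") (simp_all add: c_def)
    then show "exp (\<bar>corrected_error \<sigma> n a b\<bar> / (4 * sqrt n))
      \<le> exp (c * corrected_error \<sigma> n a b) + exp (- c * corrected_error \<sigma> n a b)" .
  qed
  also have "\<dots> \<le> (4 * (1 + (4 * c)\<^sup>2)) ^ n + (4 * (1 + (4 * (- c))\<^sup>2)) ^ n"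
    unfolding sum.distrib using c(2) by (intro add_mono corrected_error_exp_moment) auto
  also have "\<dots> \<le> 2 * exp 1 * 4 ^ n"
    using e c(3) by simp
  finally show ?thesis .
qed

section \<open>From the local discrepancy to the grid\<close>

lemma finite_hammersley: "finite (hammersley n \<sigma>)"
  by (simp add: hammersley_eq)

lemma reflection_eq_image:
  "{(x, 1 - y) | x y. (x, y) \<in> H} = (\<lambda>(x, y). (x, 1 - y :: real)) ` H"
  by force

lemma card_hammersley: "card (hammersley n \<sigma>) = 2 ^ n"
  unfolding hammersley_eq by (subst card_image) (auto intro!: inj_onI)

lemma size_sym_hammersley: "size (sym_hammersley n \<sigma>) = 2 ^ (n + 1)"
proof -
  have "inj_on (\<lambda>(x, y). (x, 1 - y :: real)) (hammersley n \<sigma>)"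
    by (auto intro!: inj_onI)
  then show ?thesis
    by (simp add: sym_hammersley_def reflection_eq_image card_image card_hammersley)
qed

text \<open>Moving the corner of a box within a grid cell affects only its boundary: row
  \<open>b - 1\<close> may be lost, row \<open>b\<close> and the at most one point in column
  \<open>a\<close> may be gained. Losing row \<open>b - 1\<close> must be allowed because the
  reflected set sits one row higher.\<close>

lemma grid_count_near:
  assumes "{y. Suc y < b \<and> digit_rev \<sigma> n y < a} \<subseteq> S"
    and "S \<subseteq> {y. y < 2 ^ n \<and> y \<le> b \<and> digit_rev \<sigma> n y \<le> a}"
  shows "\<bar>real (card S) - real (grid_count \<sigma> n a b)\<bar> \<le> 2"
proof -
  let ?G = "{y. y < b \<and> digit_rev \<sigma> n y < a}"
  have fin: "finite ?G" by simp
  have finS: "finite S" using assms(2) by (rule finite_subset) auto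
  have "?G \<subseteq> insert (b - 1) S"
  proof
    fix y assume "y \<in> ?G"
    then show "y \<in> insert (b - 1) S" using assms(1) by (cases "Suc y < b") auto
  qed
  then have "card ?G \<le> card (insert (b - 1) S)" by (intro card_mono) (auto simp: finS)
  also have "\<dots> \<le> card S + 1" using card_insert_le_m1[of "card S + 1" S "b - 1"] by simp
  finally have 1: "card ?G \<le> card S + 1" .
  define T where "T = {y \<in> {..<2 ^ n}. digit_rev \<sigma> n y = a}"
  have "card T = card (digit_rev \<sigma> n ` T)"
    by (rule card_image[symmetric], rule inj_on_subset[OF digit_rev_inj]) (auto simp: T_def)
  also have "\<dots> \<le> card {a}" by (intro card_mono) (auto simp: T_def)
  finally have T: "card T \<le> 1" by simp
  have "S \<subseteq> ?G \<union> ({b} \<union> T)" using assms(2) by (auto simp: T_def)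
  then have "card S \<le> card (?G \<union> ({b} \<union> T))" by (intro card_mono) (auto simp: T_def)
  also have "\<dots> \<le> card ?G + (card {b} + card T)"
    using card_Un_le[of ?G "{b} \<union> T"] card_Un_le[of "{b}" T] by linarith
  finally have "card S \<le> card ?G + 2" using T by simp
  with 1 show ?thesis by (simp add: grid_count_def)
qed

lemma local_disc_near_corrected_error:
  fixes t u :: real
  assumes a: "a < 2 ^ n" "real a / 2 ^ n \<le> t" "t \<le> (real a + 1) / 2 ^ n"
    and b: "b < 2 ^ n" "real b / 2 ^ n \<le> u" "u \<le> (real b + 1) / 2 ^ n"
  shows "2 ^ (n + 1) * \<bar>local_disc (sym_hammersley n \<sigma>) (t, u)\<bar> \<le> \<bar>corrected_error \<sigma> n a b\<bar> + 9"
proof -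
  let ?q = "2 ^ n :: real"
  let ?\<tau> = "Suc \<circ> \<sigma>"
  define x where "x = t * ?q"
  define y where "y = u * ?q"
  have x: "real a \<le> x" "x \<le> real a + 1" and y: "real b \<le> y" "y \<le> real b + 1"
    using a b by (auto simp: x_def y_def field_simps)
  define S1 where "S1 = {k. k < 2 ^ n \<and> real (digit_rev \<sigma> n k) < x \<and> real k < y}"
  \<comment> \<open>Reflecting row \<open>2 ^ n - 1 - k\<close> gives the ordinate
    \<open>(k + 1) / 2 ^ n\<close>; by \<open>digit_rev_complement\<close> its abscissa is that of
    row \<open>k\<close> for the complementary shift.\<close>
  define S2 where "S2 = {k. k < 2 ^ n \<and> real (digit_rev ?\<tau> n k) < x \<and> real k + 1 < y}"
  let ?B = "{0..<t} \<times> {0..<u}"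
  have c1: "size {#z \<in># mset_set (hammersley n \<sigma>). z \<in> ?B#} = card S1"
  proof -
    have "{z \<in> hammersley n \<sigma>. z \<in> ?B} = (\<lambda>y. (real (digit_rev \<sigma> n y) / ?q, real y / ?q)) ` S1"
      by (auto simp: hammersley_eq S1_def x_def y_def field_simps)
    then have "card {z \<in> hammersley n \<sigma>. z \<in> ?B} = card S1"
      by (simp, subst card_image) (auto intro!: inj_onI)
    then show ?thesis using finite_hammersley by (simp add: filter_mset_mset_set)
  qed
  have c2: "size {#z \<in># mset_set {(x, 1 - y) | x y. (x, y) \<in> hammersley n \<sigma>}. z \<in> ?B#} = card S2"
  proof -
    have comp: "digit_rev ?\<tau> n k = digit_rev \<sigma> n (2 ^ n - 1 - k)" if "k < 2 ^ n" for k
      using digit_rev_complement[of "2 ^ n - 1 - k" n \<sigma>] that by simp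
    have "(\<lambda>k. 2 ^ n - 1 - k) ` {..<2 ^ n} = {..<2 ^ n :: nat}"
    proof (intro equalityI subsetI)
      fix k assume "k \<in> {..<2 ^ n :: nat}"
      then show "k \<in> (\<lambda>k. 2 ^ n - 1 - k) ` {..<2 ^ n}"
        by (intro image_eqI[of _ _ "2 ^ n - 1 - k"]) auto
    qed auto
    then have "hammersley n \<sigma> =
      (\<lambda>k. (real (digit_rev \<sigma> n k) / ?q, real k / ?q)) ` (\<lambda>k. 2 ^ n - 1 - k) ` {..<2 ^ n}"
      by (simp add: hammersley_eq)
    also have "\<dots> = (\<lambda>k. (real (digit_rev ?\<tau> n k) / ?q, 1 - (real k + 1) / ?q)) ` {..<2 ^ n}"
      unfolding image_image by (intro image_cong refl) (auto simp: comp of_nat_diff field_simps)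
    finally have "{(x, 1 - y) | x y. (x, y) \<in> hammersley n \<sigma>} =
      (\<lambda>k. (real (digit_rev ?\<tau> n k) / ?q, (real k + 1) / ?q)) ` {..<2 ^ n}"
      unfolding reflection_eq_image by (simp add: image_image)
    then have "{z \<in> {(x, 1 - y) | x y. (x, y) \<in> hammersley n \<sigma>}. z \<in> ?B} =
      (\<lambda>k. (real (digit_rev ?\<tau> n k) / ?q, (real k + 1) / ?q)) ` S2"
      by (auto simp: S2_def x_def y_def field_simps)
    then have "card {z \<in> {(x, 1 - y) | x y. (x, y) \<in> hammersley n \<sigma>}. z \<in> ?B} = card S2"
      by (simp only:, subst card_image) (auto intro!: inj_onI)
    moreover have "finite {(x, 1 - y) | x y. (x, y) \<in> hammersley n \<sigma>}"
      unfolding reflection_eq_image using finite_hammersley by simp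
    ultimately show ?thesis by (simp only: filter_mset_mset_set size_mset_set)
  qed
  have n1: "\<bar>real (card S1) - real (grid_count \<sigma> n a b)\<bar> \<le> 2"
    using x y a(1) b(1) by (intro grid_count_near) (auto simp: S1_def)
  have n2: "\<bar>real (card S2) - real (grid_count ?\<tau> n a b)\<bar> \<le> 2"
    using x y a(1) b(1) by (intro grid_count_near) (auto simp: S2_def)
  \<comment> \<open>The two products differ by at most \<open>a + b + 1\<close>, which is below
    \<open>2 * 2 ^ n\<close>.\<close>
  have "x * y \<le> (real a + 1) * (real b + 1)" "real a * real b \<le> x * y"
    using x y by (auto intro!: mult_mono)
  moreover have "real a + 1 \<le> ?q" "real b + 1 \<le> ?q"
    using a(1) b(1) by (metis Suc_leI add.commute of_nat_Suc of_nat_le_iff of_nat_numeral of_nat_power)+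
  ultimately have "\<bar>x * y - real a * real b\<bar> \<le> 2 * ?q"
    by (simp add: algebra_simps)
  then have "\<bar>x * y - real a * real b\<bar> / ?q \<le> 2"
    by (simp add: divide_le_eq)
  then have v: "\<bar>x * y / ?q - real a * real b / ?q\<bar> \<le> 2"
    by (simp add: diff_divide_distrib[symmetric])
  have "2 ^ (n + 1) * local_disc (sym_hammersley n \<sigma>) (t, u) = real (card S1) + real (card S2) - 2 * (x * y / ?q)"
    unfolding local_disc_def size_sym_hammersley fst_conv snd_conv
    using c1 c2 by (simp add: sym_hammersley_def x_def y_def field_simps)
  moreover have "\<bar>row_error \<sigma> n a b\<bar> \<le> 1" "\<bar>row_error ?\<tau> n a b\<bar> \<le> 1"
    using a(1) by (auto intro!: row_error_bound)
  \<comment> \<open>The 9 consists of \<open>2 + 2\<close> for the two counts, \<open>2 * 2\<close>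
    for the area, which enters twice, and 1 for the half sum of the row errors.\<close>
  moreover have "\<bar>d\<bar> \<le> \<bar>(g1 - w) + (g2 - w) + (r1 + r2) / 2\<bar> + 9"
    if "d = s1 + s2 - 2 * v" "\<bar>r1\<bar> \<le> 1" "\<bar>r2\<bar> \<le> 1" "\<bar>s1 - g1\<bar> \<le> 2" "\<bar>s2 - g2\<bar> \<le> 2" "\<bar>v - w\<bar> \<le> 2"
    for d s1 s2 v r1 r2 g1 g2 w :: real
  proof -
    have "\<bar>d - ((g1 - w) + (g2 - w) + (r1 + r2) / 2)\<bar> \<le> 9"
      using that unfolding abs_le_iff by (simp add: field_simps)
    then show ?thesis by linarith
  qed
  ultimately have "\<bar>2 ^ (n + 1) * local_disc (sym_hammersley n \<sigma>) (t, u)\<bar> \<le> \<bar>corrected_error \<sigma> n a b\<bar> + 9"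
    using n1 n2 v unfolding corrected_error_def grid_error_def by blast
  then show ?thesis by (simp add: abs_mult)
qed

section \<open>Integration over the unit square\<close>

lemma unit_interval_grid_cell:
  fixes t :: real
  assumes "t \<in> {0..1}"
  shows "\<exists>a<2 ^ n. real a / 2 ^ n \<le> t \<and> t \<le> (real a + 1) / 2 ^ n"
proof (cases "t = 1")
  case True
  \<comment> \<open>The floor would give the index \<open>2 ^ n\<close>, out of range; the last
    closed cell still contains 1.\<close>
  then show ?thesis by (intro exI[of _ "2 ^ n - 1"]) (auto simp: of_nat_diff)
next
  case False
  define a where "a = nat \<lfloor>t * 2 ^ n\<rfloor>"
  have "t * 2 ^ n < 2 ^ n" using False assms by simp
  moreover have "real a \<le> t * 2 ^ n" "t * 2 ^ n \<le> real a + 1"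
    using assms unfolding a_def by auto
  moreover from calculation have "real a < 2 ^ n" by linarith
  then have "real a < real (2 ^ n)" by simp
  then have "a < 2 ^ n" by (simp only: of_nat_less_iff)
  ultimately show ?thesis
    by (intro exI[of _ a]) (auto simp: field_simps)
qed

lemma powr_le_const_exp:
  fixes p :: real
  assumes "0 < p"
  shows "\<exists>K>0. \<forall>x\<ge>0. x powr p \<le> K * exp x"
proof (intro exI conjI allI impI)
  \<comment> \<open>The constant comes from raising \<open>x / p \<le> exp (x / p)\<close> to the
    power \<open>p\<close>.\<close>
  show "p powr p > 0" using assms by simp
  fix x :: real assume x: "0 \<le> x"
  have "x / p \<le> exp (x / p)" using exp_ge_add_one_self[of "x / p"] by linarith
  then have "(x / p) powr p \<le> exp (x / p) powr p"
    using x assms by (intro powr_mono2) auto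
  then show "x powr p \<le> p powr p * exp x"
    using x assms by (simp add: powr_divide powr_def[of "exp _"] field_simps)
qed

text \<open>The majorant \<open>h\<close> is a step function on closed cells of area
  \<open>1 / 4 ^ n\<close>. On shared edges several of its terms count, which only increases it as
  \<open>g\<close> is nonnegative.\<close>

lemma integral_le_grid_sum:
  fixes f :: "real \<times> real \<Rightarrow> real" and g :: "nat \<Rightarrow> nat \<Rightarrow> real"
  assumes g: "\<And>a b. 0 \<le> g a b"
    and f: "\<And>a b t u. a < 2 ^ n \<Longrightarrow> real a / 2 ^ n \<le> t \<Longrightarrow> t \<le> (real a + 1) / 2 ^ n \<Longrightarrow>
      b < 2 ^ n \<Longrightarrow> real b / 2 ^ n \<le> u \<Longrightarrow> u \<le> (real b + 1) / 2 ^ n \<Longrightarrow> f (t, u) \<le> g a b"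
  shows "(LINT z:{0..1} \<times> {0..1}|lborel. f z) \<le> (\<Sum>a<2 ^ n. \<Sum>b<2 ^ n. g a b) / 4 ^ n"
proof -
  define Q where "Q a b = cbox (real a / 2 ^ n, real b / 2 ^ n) ((real a + 1) / 2 ^ n, (real b + 1) / 2 ^ n)" for a b
  define h where "h z = (\<Sum>a<2 ^ n. \<Sum>b<2 ^ n. g a b * indicator (Q a b) z)" for z
  have content: "measure lborel (Q a b) = 1 / 4 ^ n" for a b
    unfolding Q_def content_Pair by (simp add: field_simps flip: power_mult_distrib)
  have fin: "emeasure lborel (Q a b) < \<infinity>" for a b
    unfolding Q_def by (rule emeasure_lborel_cbox_finite)
  have int: "integrable lborel (\<lambda>z. g a b * indicator (Q a b) z)" for a b
    using fin[of a b] by (intro integrable_mult_right integrable_real_indicator) (auto simp: Q_def)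
  have "(LINT z:{0..1} \<times> {0..1}|lborel. f z) \<le> integral\<^sup>L lborel h"
    unfolding set_lebesgue_integral_def
  \<comment> \<open>This rule also covers a non-integrable integrand: its Bochner integral is 0 by
    convention, hence below that of the nonnegative \<open>h\<close>.\<close>
  proof (rule integral_mono')
    show "integrable lborel h" unfolding h_def by (intro Bochner_Integration.integrable_sum int)
    fix z :: "real \<times> real"
    show h0: "0 \<le> h z" unfolding h_def by (intro sum_nonneg mult_nonneg_nonneg g) auto
    show "indicator ({0..1} \<times> {0..1}) z *\<^sub>R f z \<le> h z"
    proof (cases "z \<in> {0..1} \<times> {0..1}")
      case True
      obtain t u where z: "z = (t, u)" by fastforce
      obtain a where a: "a < 2 ^ n" "real a / 2 ^ n \<le> t" "t \<le> (real a + 1) / 2 ^ n"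
        using True z unit_interval_grid_cell[of t n] by auto
      obtain b where b: "b < 2 ^ n" "real b / 2 ^ n \<le> u" "u \<le> (real b + 1) / 2 ^ n"
        using True z unit_interval_grid_cell[of u n] by auto
      have "z \<in> Q a b" using a b by (simp add: z Q_def cbox_Pair_eq)
      then have "f z \<le> g a b * indicator (Q a b) z"
        using f[OF a b] by (simp add: z)
      also have "\<dots> \<le> (\<Sum>b<2 ^ n. g a b * indicator (Q a b) z)"
        using b g by (intro member_le_sum) auto
      also have "\<dots> \<le> h z"
        unfolding h_def
        using a g by (intro member_le_sum[where f = "\<lambda>a. \<Sum>b<2 ^ n. g a b * indicator (Q a b) z"])
          (auto intro!: sum_nonneg)
      finally show ?thesis using True by simp
    qed (use h0 in simp)
  qed
  also have "integral\<^sup>L lborel h = (\<Sum>a<2 ^ n. \<Sum>b<2 ^ n. g a b * (1 / 4 ^ n))"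
  proof -
    have "integral\<^sup>L lborel (\<lambda>z. g a b * indicator (Q a b) z) = g a b * (1 / 4 ^ n)" for a b
      by (simp add: content)
    then show ?thesis
      unfolding h_def by (simp only: Bochner_Integration.integral_sum Bochner_Integration.integrable_sum int)
  qed
  also have "\<dots> = (\<Sum>a<2 ^ n. \<Sum>b<2 ^ n. g a b) / 4 ^ n"
    by (simp add: sum_divide_distrib)
  finally show ?thesis .
qed

text \<open>The \<open>p\<close>-th power of the rescaled discrepancy is dominated by its
  exponential, whose mean over the grid is bounded; the \<open>p\<close>-th root then restores the
  scale.\<close>

lemma Lp_disc_sym_hammersley:
  assumes "0 < p"
  shows "\<exists>C>0. \<forall>n\<ge>1. \<forall>\<sigma>. Lp_disc p (sym_hammersley n \<sigma>) \<le> C * sqrt n / 2 ^ (n + 1)"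
proof -
  obtain K where K: "K > 0" "\<And>x. x \<ge> 0 \<Longrightarrow> x powr p \<le> K * exp x"
    using powr_le_const_exp[OF assms] by auto
  \<comment> \<open>The factors come from \<open>powr_le_const_exp\<close>, from the cell error 9
    and from the exponential moment.\<close>
  define L where "L = K * exp 9 * (2 * exp 1)"
  have L: "L > 0" using K by (simp add: L_def)
  have "Lp_disc p (sym_hammersley n \<sigma>) \<le> 4 * L powr (1 / p) * sqrt n / 2 ^ (n + 1)"
    if n: "1 \<le> n" for n \<sigma>
  proof -
    \<comment> \<open>Division by \<open>s\<close> turns the bound of
      \<open>local_disc_near_corrected_error\<close> into the exponent of the moment estimate plus
      at most 9.\<close>
    define s where "s = 4 * sqrt n / 2 ^ (n + 1)"
    have s: "s > 0" using n by (simp add: s_def)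
    let ?D = "local_disc (sym_hammersley n \<sigma>)"
    let ?g = "\<lambda>a b. s powr p * (K * exp 9) * exp (\<bar>corrected_error \<sigma> n a b\<bar> / (4 * sqrt n))"
    have "(LINT z:{0..1} \<times> {0..1}|lborel. \<bar>?D z\<bar> powr p) \<le> (\<Sum>a<2 ^ n. \<Sum>b<2 ^ n. ?g a b) / 4 ^ n"
    proof (rule integral_le_grid_sum)
      fix a b and t u :: real
      assume ab: "a < 2 ^ n" "real a / 2 ^ n \<le> t" "t \<le> (real a + 1) / 2 ^ n"
        "b < 2 ^ n" "real b / 2 ^ n \<le> u" "u \<le> (real b + 1) / 2 ^ n"
      let ?M = "\<bar>corrected_error \<sigma> n a b\<bar>"
      have "\<bar>?D (t, u)\<bar> / s = 2 ^ (n + 1) * \<bar>?D (t, u)\<bar> / (4 * sqrt n)"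
        by (simp add: s_def)
      also have "\<dots> \<le> (?M + 9) / (4 * sqrt n)"
        by (intro divide_right_mono local_disc_near_corrected_error ab) auto
      also have "\<dots> \<le> ?M / (4 * sqrt n) + 9"
      proof -
        have "1 \<le> sqrt n" using n by simp
        then have "9 / (4 * sqrt n) \<le> 9 / 1" by (intro divide_left_mono) linarith+
        then show ?thesis by (simp add: add_divide_distrib)
      qed
      finally have le: "\<bar>?D (t, u)\<bar> / s \<le> ?M / (4 * sqrt n) + 9" .
      have "\<bar>?D (t, u)\<bar> powr p = s powr p * (\<bar>?D (t, u)\<bar> / s) powr p"
        using s by (simp add: powr_divide)
      also have "\<dots> \<le> s powr p * (K * exp (\<bar>?D (t, u)\<bar> / s))"
        using s by (intro mult_left_mono K(2)) auto
      also have "\<dots> \<le> s powr p * (K * exp (?M / (4 * sqrt n) + 9))"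
        using le K(1) by (intro mult_left_mono) auto
      finally show "\<bar>?D (t, u)\<bar> powr p \<le> ?g a b"
        by (simp add: exp_add mult_ac)
    qed (use K(1) in simp)
    also have "\<dots> = s powr p * (K * exp 9) *
        (\<Sum>a<2 ^ n. \<Sum>b<2 ^ n. exp (\<bar>corrected_error \<sigma> n a b\<bar> / (4 * sqrt n))) / 4 ^ n"
      by (simp only: sum_distrib_left)
    also have "\<dots> \<le> s powr p * (K * exp 9) * (2 * exp 1 * 4 ^ n) / 4 ^ n"
      using K(1) n by (intro divide_right_mono mult_left_mono corrected_error_exp_moment_sqrt) auto
    also have "\<dots> = s powr p * L" by (simp add: L_def)
    finally have "(LINT z:{0..1} \<times> {0..1}|lborel. \<bar>?D z\<bar> powr p) \<le> s powr p * L" .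
    moreover have "0 \<le> (LINT z:{0..1} \<times> {0..1}|lborel. \<bar>?D z\<bar> powr p)"
      unfolding set_lebesgue_integral_def by (intro Bochner_Integration.integral_nonneg) auto
    ultimately have "Lp_disc p (sym_hammersley n \<sigma>) \<le> (s powr p * L) powr (1 / p)"
      unfolding Lp_disc_def using assms by (intro powr_mono2) auto
    also have "\<dots> = s * L powr (1 / p)"
      using s L assms by (simp add: powr_mult powr_powr)
    finally show ?thesis by (simp add: s_def mult_ac)
  qed
  moreover have "4 * L powr (1 / p) > 0" using L by simp
  ultimately show ?thesis by blast
qed

theorem theorem3:
  fixes p :: real
  assumes "1 < p"
  shows "\<exists>C>0. \<forall>n\<ge>1. \<forall>\<sigma>\<in>bits n. \<forall>N. N = 2 ^ (n + 1) \<longrightarrow>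
           size (sym_hammersley n \<sigma>) = N \<and>
           Lp_disc p (sym_hammersley n \<sigma>) \<le> C * (sqrt (ln (real N)) / real N)"
proof -
  obtain C where C: "C > 0"
    "\<And>n \<sigma>. n \<ge> 1 \<Longrightarrow> Lp_disc p (sym_hammersley n \<sigma>) \<le> C * sqrt n / 2 ^ (n + 1)"
    using Lp_disc_sym_hammersley[of p] assms by (meson less_trans zero_less_one)
  have "Lp_disc p (sym_hammersley n \<sigma>) \<le> 2 * C * (sqrt (ln (2 ^ (n + 1))) / 2 ^ (n + 1))"
    if "n \<ge> 1" for n \<sigma>
  proof -
    \<comment> \<open>The bound \<open>ln 2 \<ge> 1 / 2\<close> compares \<open>n\<close> with
      \<open>ln N\<close>. The generous factor 4 is taken as a square; its root is the 2 in the
      final constant.\<close>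
    have "real (n + 1) * (1 / 2) \<le> real (n + 1) * ln 2"
      using ln2_ge_two_thirds by (intro mult_left_mono) auto
    then have "real n \<le> 4 * ln (2 ^ (n + 1))"
      by (subst ln_realpow) (auto simp: field_simps)
    then have "sqrt n \<le> 2 * sqrt (ln (2 ^ (n + 1)))"
      using real_sqrt_le_mono[of "real n" "4 * ln (2 ^ (n + 1))"] by (simp add: real_sqrt_mult)
    then have "C * sqrt n / 2 ^ (n + 1) \<le> C * (2 * sqrt (ln (2 ^ (n + 1)))) / 2 ^ (n + 1)"
      using C(1) by (intro divide_right_mono mult_left_mono) auto
    with C(2)[OF that, of \<sigma>] show ?thesis by (simp add: mult_ac)
  qed
  moreover have "2 * C > 0" using C(1) by simp
  ultimately show ?thesis
    unfolding size_sym_hammersley by (intro exI[of _ "2 * C"]) simp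
qed

end
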